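(* Let $(A,B,p,r,c_R)$ be a linear production situation with a common-pool resource with producer set $N$, let $P=\{S_1,\ldots,S_k\}$ be a partition of $N$ with $d(P)>r$, and let $(X_1,\ldots,X_k;\pi_1,\ldots,\pi_k)$ be the associated non cooperative game among the coalitions of $P$. Then: (a) every strict Nash equilibrium of the game is a strong Nash equilibrium; (b) every $z\in\prod_{i=1}^k[0,d_{S_i}]$ with $\sum_{i=1}^k z_i=r$ and $z_j=0$ for some $j\in\{1,\ldots,k\}$ is a strong Nash equilibrium that is not a strict Nash equilibrium; (c) the set of strict Nash equilibria is a proper subset of the set of strong Nash equilibria, which in turn is a proper subset of the set of Nash equilibria.
   Context: Linear production situation with a common-pool resource $(A,B,p,r,c_R)$: $N=\{1,\ldots,n\}$ is a set of producers, $Q=\{1,\ldots,q\}$ a set of resources, $G=\{1,\ldots,g\}$ a set of goods. Each producer $i\in N$ owns a resource vector $b^i\in\mathbb{R}_+^q$; $B$ is the $q\times n$ matrix of these vectors, and for each resource $t\in Q$ there is a producer $i\in N$ with $b^i_t>0$. For a coalition $S\subseteq N$, $b^S=\sum_{i\in S}b^i$. In addition there is a common-pool resource, owned by an external agent, whose total available amount is $r$ and whose cost per unit $c_R$ is fixed exogenously. $A$ is the $(q+1)\times g$ production matrix, whose entry $a_{tj}$ is the amount of resource $t$ needed to produce product $j$; row $q+1$ refers to the common-pool resource, $a_{(q+1)j}>0$ for all $j\in G$, and for each $j\in G$ there is at least one resource $t\in Q$ with $a_{tj}>0$. The price vector $p\in\mathbb{R}^g$ has strictly positive entries and $p_j>a_{(q+1)j}c_R$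 for all $j\in G$. For a coalition $S$ and $z\ge 0$, $value(S;z)$ is the maximum over $x\in\mathbb{R}^g$, $x\ge 0$, of $\sum_{j=1}^g p_jx_j-c_Rz$ subject to $Ax\le \begin{pmatrix} b^S\\ z\end{pmatrix}$. The optimal demand of $S$ is $d_S=\min\{z\in\mathbb{R}_+ : value(S;z)\text{ is maximum}\}$, i.e. the least maximizer of $z\mapsto value(S;z)$ over $\mathbb{R}_+$. Standing assumption: for every coalition $S$ there is a feasible production plan $(x;z)$ such that $value(S;z)>0$ (which implies $d_S>0$). For a partition $P=\{S_1,\ldots,S_k\}$ of $N$, $d(P)=\sum_{i=1}^k d_{S_i}$. The non cooperative game $(X_1,\ldots,X_k;\pi_1,\ldots,\pi_k)$ among the coalitions of $P$: player $i$ is coalition $S_i$, its strategy set is $X_i=[0,d_{S_i}]$, and its payoff is $\pi_i(z_1,\ldots,z_k)=0$ if $\sum_{l=1}^k z_l>r$ and $\pi_i(z_1,\ldots,z_k)=value(S_i;z_i)$ otherwise. All equilibria are in pure strategies. A profile $z^*\in\prod_{i=1}^k X_i$ is a Nash equilibrium if for all $i$ and all $z_i\in X_i$, $\pi_i(z^* )\ge\pi_i(z_1^*,\ldots,z_{i-1}^*,z_i,z_{i+1}^*,\ldots,z_k^* )$. It is a strict Nash equilibrium if for all $i$ and all $z_i\in X_i\setminus\{z_i^*\}$, $\pi_i(z^* )>\pi_i(z_1^*,\ldots,z_{i-1}^*,z_i,z_{i+1}^*,\ldots,z_k^* )$. It is a strong Nash equilibrium if for every nonempty subset $M$ of the set of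 players (possibly all of them) there is no $z_M\in X_M=\prod_{i\in M}X_i$ such that $\pi_i(z_M,z^*_{-M})>\pi_i(z^* )$ for all $i\in M$, where $(z_M,z^*_{-M})$ is the profile in which players in $M$ play $z_M$ and the others play according to $z^*$.
   Formalization: Part (c) fails for some games (e.g. P={N}); formalized as: both inclusions always hold; strict in strong is proper iff d(P)-d_S ≥ r for some S in P; strong in Nash is proper iff r>0 and d(P)-d_S ≥ r for all S in P; and both are proper for some situation and partition. *)

theory Defs
  imports Complex_Main "HOL-Library.FuncSet" "HOL-Library.Disjoint_Sets"
begin

section \<open>Equilibria of games in strategic form\<close>

text \<open>
  A game consists of a set of players \<open>I\<close>, strategy sets \<open>X i\<close> and payoff functions \<open>u i\<close>.
  Profiles are extensional functions on \<open>I\<close>, so that sets of equilibria may be compared as sets.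
\<close>

definition nash_equilibria :: "'i set \<Rightarrow> ('i \<Rightarrow> 'a set) \<Rightarrow> ('i \<Rightarrow> ('i \<Rightarrow> 'a) \<Rightarrow> real) \<Rightarrow> ('i \<Rightarrow> 'a) set"
  where "nash_equilibria I X u =
    {z \<in> Pi\<^sub>E I X. \<forall>i\<in>I. \<forall>y\<in>X i. u i z \<ge> u i (z(i := y))}"

definition strict_nash_equilibria :: "'i set \<Rightarrow> ('i \<Rightarrow> 'a set) \<Rightarrow> ('i \<Rightarrow> ('i \<Rightarrow> 'a) \<Rightarrow> real) \<Rightarrow> ('i \<Rightarrow> 'a) set"
  where "strict_nash_equilibria I X u =
    {z \<in> Pi\<^sub>E I X. \<forall>i\<in>I. \<forall>y\<in>X i - {z i}. u i z > u i (z(i := y))}"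

definition strong_nash_equilibria :: "'i set \<Rightarrow> ('i \<Rightarrow> 'a set) \<Rightarrow> ('i \<Rightarrow> ('i \<Rightarrow> 'a) \<Rightarrow> real) \<Rightarrow> ('i \<Rightarrow> 'a) set"
  where "strong_nash_equilibria I X u =
    {z \<in> Pi\<^sub>E I X. \<forall>M. M \<subseteq> I \<and> M \<noteq> {} \<longrightarrow>
       \<not> (\<exists>y \<in> Pi\<^sub>E M X. \<forall>i\<in>M. u i (override_on z y M) > u i z)}"


section \<open>Linear production situations with a common-pool resource\<close>

text \<open>
  Producers are \<open>{1..num_producers L}\<close>, and similarly for resources and goods.
  \<open>tech L t j\<close> is the entry \<open>a\<^sub>t\<^sub>j\<close> of the production matrix, whose row \<open>num_resources L + 1\<close>
  belongs to the common-pool resource; \<open>endow L t i\<close> is the amount of resource \<open>t\<close> owned by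
  producer \<open>i\<close>. Values outside these index ranges are irrelevant.
\<close>

record lp_situation =
  num_producers :: nat
  num_resources :: nat
  num_goods :: nat
  tech :: "nat \<Rightarrow> nat \<Rightarrow> real"
  endow :: "nat \<Rightarrow> nat \<Rightarrow> real"
  price :: "nat \<Rightarrow> real"
  pool :: real
  unit_cost :: real

definition coalition_endow :: "lp_situation \<Rightarrow> nat set \<Rightarrow> nat \<Rightarrow> real"
  where "coalition_endow L S t = (\<Sum>i\<in>S. endow L t i)"

definition feasible_plan :: "lp_situation \<Rightarrow> nat set \<Rightarrow> real \<Rightarrow> (nat \<Rightarrow> real) \<Rightarrow> bool"
  where "feasible_plan L S z x \<longleftrightarrow>
    (\<forall>j\<in>{1..num_goods L}. 0 \<le> x j) \<and>
    (\<forall>t\<in>{1..num_resources L}. (\<Sum>j=1..num_goods L. tech L t j * x j) \<le> coalition_endow L S t) \<and>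
    (\<Sum>j=1..num_goods L. tech L (num_resources L + 1) j * x j) \<le> z"

text \<open>
  In a situation as in \<open>valid_situation\<close> below, the maximum in \<open>coalition_value\<close> exists for every
  \<open>z \<ge> 0\<close>, and so does the least maximizer in \<open>optimal_demand\<close>.
\<close>

definition coalition_value :: "lp_situation \<Rightarrow> nat set \<Rightarrow> real \<Rightarrow> real"
  where "coalition_value L S z =
    (GREATEST v. \<exists>x. feasible_plan L S z x \<and>
       v = (\<Sum>j=1..num_goods L. price L j * x j) - unit_cost L * z)"

definition optimal_demand :: "lp_situation \<Rightarrow> nat set \<Rightarrow> real"
  where "optimal_demand L S =
    (LEAST z. 0 \<le> z \<and> (\<forall>y\<ge>0. coalition_value L S y \<le> coalition_value L S z))"

definition valid_situation :: "lp_situation \<Rightarrow> bool"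
  where "valid_situation L \<longleftrightarrow>
    1 \<le> num_producers L \<and> 1 \<le> num_resources L \<and> 1 \<le> num_goods L \<and>
    (\<forall>t\<in>{1..num_resources L}. \<forall>i\<in>{1..num_producers L}. 0 \<le> endow L t i) \<and>
    (\<forall>t\<in>{1..num_resources L}. \<exists>i\<in>{1..num_producers L}. 0 < endow L t i) \<and>
    (\<forall>t\<in>{1..num_resources L + 1}. \<forall>j\<in>{1..num_goods L}. 0 \<le> tech L t j) \<and>
    (\<forall>j\<in>{1..num_goods L}. 0 < tech L (num_resources L + 1) j) \<and>
    (\<forall>j\<in>{1..num_goods L}. \<exists>t\<in>{1..num_resources L}. 0 < tech L t j) \<and>
    0 \<le> pool L \<and> 0 \<le> unit_cost L \<and>
    (\<forall>j\<in>{1..num_goods L}. 0 < price L j \<and>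
       tech L (num_resources L + 1) j * unit_cost L < price L j) \<and>
    (\<forall>S. S \<subseteq> {1..num_producers L} \<and> S \<noteq> {} \<longrightarrow>
       (\<exists>x z. 0 \<le> z \<and> feasible_plan L S z x \<and> 0 < coalition_value L S z))"

definition total_demand :: "lp_situation \<Rightarrow> nat set set \<Rightarrow> real"
  where "total_demand L P = (\<Sum>S\<in>P. optimal_demand L S)"


section \<open>The game among the coalitions of a partition\<close>

text \<open>The players are the coalitions of the partition \<open>P\<close> themselves, rather than their indices.\<close>

definition strategies :: "lp_situation \<Rightarrow> nat set \<Rightarrow> real set"
  where "strategies L S = {0..optimal_demand L S}"

definition payoff :: "lp_situation \<Rightarrow> nat set set \<Rightarrow> nat set \<Rightarrow> (nat set \<Rightarrow> real) \<Rightarrow> real"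
  where "payoff L P S z = (if (\<Sum>T\<in>P. z T) > pool L then 0 else coalition_value L S (z S))"

abbreviation NE :: "lp_situation \<Rightarrow> nat set set \<Rightarrow> (nat set \<Rightarrow> real) set"
  where "NE L P \<equiv> nash_equilibria P (strategies L) (payoff L P)"

abbreviation strict_NE :: "lp_situation \<Rightarrow> nat set set \<Rightarrow> (nat set \<Rightarrow> real) set"
  where "strict_NE L P \<equiv> strict_nash_equilibria P (strategies L) (payoff L P)"

abbreviation strong_NE :: "lp_situation \<Rightarrow> nat set set \<Rightarrow> (nat set \<Rightarrow> real) set"
  where "strong_NE L P \<equiv> strong_nash_equilibria P (strategies L) (payoff L P)"

end

(* The value of a coalition vanishes at 0 and, by concavity and because the optimal demand is its
   least maximizer, increases strictly up to the optimal demand. Hence every profile that uses up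
   the pool exactly is a strong equilibrium: a profitable deviation may not exceed the pool, but it
   raises the demand of every deviating coalition. Such a profile is strict iff no demand is zero.
   All other equilibria overuse the pool in such a way that no coalition can remedy this alone; if
   the pool is not empty, then the grand coalition can. *)

theory Submission
  imports Defs "HOL-Analysis.Function_Topology"
begin

section \<open>Equilibria of games with a common pool\<close>

text \<open>A unilateral deviation is a deviation of the coalition that consists of this player
  only.\<close>

lemma strong_nash_subset_nash: "strong_nash_equilibria I X u \<subseteq> nash_equilibria I X u"
proof
  fix z assume z: "z \<in> strong_nash_equilibria I X u"
  have "u i (z(i := y)) \<le> u i z" if "i \<in> I" "y \<in> X i" for i y
  proof (rule ccontr)
    assume "\<not> ?thesis"
    moreover have "override_on z (\<lambda>j\<in>{i}. y) {i} = z(i := y)"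
      by (auto simp: override_on_def)
    ultimately have "\<forall>j\<in>{i}. u j z < u j (override_on z (\<lambda>j\<in>{i}. y) {i})"
      by simp
    moreover have "(\<lambda>j\<in>{i}. y) \<in> Pi\<^sub>E {i} X"
      using that by auto
    moreover have "{i} \<subseteq> I \<and> {i} \<noteq> {}"
      using that by simp
    ultimately show False
      using z unfolding strong_nash_equilibria_def by blast
  qed
  then show "z \<in> nash_equilibria I X u"
    using z by (simp add: strong_nash_equilibria_def nash_equilibria_def)
qed

section \<open>The abstract game: players with strictly increasing values and a scarce pool\<close>

locale pool_game =
  fixes I :: "'i set" and d :: "'i \<Rightarrow> real" and v :: "'i \<Rightarrow> real \<Rightarrow> real" and r :: real
  assumes finite_players: "finite I"
    and players_nonempty: "I \<noteq> {}"
    and demand_pos: "i \<in> I \<Longrightarrow> 0 < d i"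
    and value_zero: "i \<in> I \<Longrightarrow> v i 0 = 0"
    and value_strict_mono: "i \<in> I \<Longrightarrow> strict_mono_on {0..d i} (v i)"
    and pool_nonneg: "0 \<le> r"
    and scarcity: "r < sum d I"
begin

definition u :: "'i \<Rightarrow> ('i \<Rightarrow> real) \<Rightarrow> real"
  where "u i z = (if sum z I > r then 0 else v i (z i))"

definition X :: "'i \<Rightarrow> real set"
  where "X i = {0..d i}"

lemma value_less: "\<lbrakk>i \<in> I; x \<in> X i; y \<in> X i; x < y\<rbrakk> \<Longrightarrow> v i x < v i y"
  using strict_mono_onD[OF value_strict_mono] by (auto simp: X_def)

lemma value_pos: "\<lbrakk>i \<in> I; y \<in> X i; 0 < y\<rbrakk> \<Longrightarrow> 0 < v i y"
  using value_less[of i 0 y] value_zero[of i] demand_pos[of i] by (auto simp: X_def)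

text \<open>This makes overuse, which pays 0, the worst outcome for every player.\<close>

lemma payoff_nonneg: "\<lbrakk>i \<in> I; z i \<in> X i\<rbrakk> \<Longrightarrow> 0 \<le> u i z"
  using value_pos[of i "z i"] value_zero[of i] by (cases "z i = 0") (auto simp: u_def X_def)

lemma strategy_bounds: "\<lbrakk>z \<in> Pi\<^sub>E I X; i \<in> I\<rbrakk> \<Longrightarrow> 0 \<le> z i \<and> z i \<le> d i"
  by (auto simp: X_def dest!: PiE_mem)

lemma sum_update:
  fixes z :: "'i \<Rightarrow> real"
  assumes "i \<in> I"
  shows "sum (z(i := y)) I = sum z (I - {i}) + y"
proof -
  have "sum (z(i := y)) (I - {i}) = sum z (I - {i})"
    by (rule sum.cong) auto
  then show ?thesis
    using assms finite_players by (simp add: sum.remove)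
qed

lemma sum_others: "i \<in> I \<Longrightarrow> sum z I = sum z (I - {i}) + (z i :: real)"
  using finite_players by (simp add: sum.remove)

section \<open>Use of the pool in the different kinds of equilibrium\<close>

lemma nash_exhausts_pool:
  assumes z: "z \<in> nash_equilibria I X u"
  shows "r \<le> sum z I"
proof (rule ccontr)
  assume "\<not> ?thesis"
  then have less: "sum z I < r" by simp
  have zX: "z \<in> Pi\<^sub>E I X" using z by (simp add: nash_equilibria_def)
  \<comment> \<open>Otherwise the total would be at least \<open>sum d I\<close>, which exceeds
    \<open>r\<close>.\<close>
  have "\<not> (\<forall>i\<in>I. d i \<le> z i)"
    using sum_mono[of I d z] less scarcity by fastforce
  then obtain i where i: "i \<in> I" "z i < d i" by force
  \<comment> \<open>The largest strategy of player \<open>i\<close> that the others leave room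
    for.\<close>
  define y where "y = min (d i) (r - sum z (I - {i}))"
  have yX: "y \<in> X i" and gt: "z i < y"
    using i less strategy_bounds[OF zX i(1)] sum_others[OF i(1), of z] by (auto simp: y_def X_def)
  have "sum (z(i := y)) I \<le> r"
    unfolding sum_update[OF i(1)] by (simp add: y_def)
  then have "u i (z(i := y)) = v i y" "u i z = v i (z i)"
    using less by (simp_all add: u_def)
  moreover have "u i (z(i := y)) \<le> u i z"
    using z i(1) yX by (simp add: nash_equilibria_def)
  ultimately show False
    using value_less[OF i(1) PiE_mem[OF zX i(1)] yX gt] by simp
qed

text \<open>Overuse pays 0, so a player to whom the others leave some of the pool would gain by
  retreating to a positive amount that fits. This is why overuse persists only if no player can end
  it and still gain.\<close>

lemma nash_overuse:
  assumes z: "z \<in> nash_equilibria I X u" and over: "r < sum z I" and i: "i \<in> I"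
  shows "r \<le> sum z (I - {i})"
proof (rule ccontr)
  assume less: "\<not> ?thesis"
  define y where "y = min (d i) (r - sum z (I - {i}))"
  have y: "y \<in> X i" "0 < y"
    using less demand_pos[OF i] by (auto simp: y_def X_def)
  have "sum (z(i := y)) I \<le> r"
    unfolding sum_update[OF i] by (simp add: y_def)
  then have "u i (z(i := y)) = v i y" "u i z = 0"
    using over by (simp_all add: u_def)
  moreover have "u i (z(i := y)) \<le> u i z"
    using z i y by (simp add: nash_equilibria_def)
  ultimately show False
    using value_pos[OF i y] by simp
qed

text \<open>All deviators would need more of the pool, of which nothing is left.\<close>

lemma exact_use_strong:
  assumes z: "z \<in> Pi\<^sub>E I X" and exact: "sum z I = r"
  shows "z \<in> strong_nash_equilibria I X u"
proof -
  have False
    if M: "M \<subseteq> I" "M \<noteq> {}" and y: "y \<in> Pi\<^sub>E M X"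
      and better: "\<forall>i\<in>M. u i z < u i (override_on z y M)" for M y
  proof -
    let ?w = "override_on z y M"
    \<comment> \<open>Overuse would pay the deviators 0, which is no more than they have at
      \<open>z\<close>.\<close>
    have within: "\<not> r < sum ?w I"
    proof
      assume "r < sum ?w I"
      moreover obtain i where "i \<in> M" using M by auto
      ultimately show False
        using better payoff_nonneg[of i z] PiE_mem[OF z, of i] M by (fastforce simp: u_def)
    qed
    have less: "z i < y i" if "i \<in> M" for i
    proof -
      have "v i (z i) < v i (y i)"
        using bspec[OF better that] that within exact by (simp add: u_def)
      then show ?thesis
        using value_less[of i "y i" "z i"] PiE_mem[OF z, of i] PiE_mem[OF y, of i] M that
        by (cases "y i" "z i" rule: linorder_cases) auto
    qed
    \<comment> \<open>Players outside \<open>M\<close> keep their demands, and \<open>M\<close> is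
      not empty.\<close>
    have "sum z I < sum ?w I"
      using finite_players M less by (intro sum_strict_mono_ex1) (auto simp: override_on_def less_imp_le)
    then show False using within exact by simp
  qed
  then show ?thesis
    using z unfolding strong_nash_equilibria_def by blast
qed

text \<open>A strict equilibrium is a Nash equilibrium and so exhausts the pool. Under overuse a
  player has 0, and no deviation can pay strictly less than that.\<close>

lemma strict_exact_use:
  assumes z: "z \<in> strict_nash_equilibria I X u"
  shows "sum z I = r"
proof -
  have zX: "z \<in> Pi\<^sub>E I X" using z by (simp add: strict_nash_equilibria_def)
  have "z \<in> nash_equilibria I X u"
    unfolding nash_equilibria_def
  proof (intro CollectI conjI ballI zX)
    fix i y assume "i \<in> I" "y \<in> X i"
    then show "u i (z(i := y)) \<le> u i z"
      using z by (cases "y = z i") (auto simp: strict_nash_equilibria_def less_imp_le)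
  qed
  then have "r \<le> sum z I" by (rule nash_exhausts_pool)
  moreover have "\<not> r < sum z I"
  proof
    assume "r < sum z I"
    moreover obtain i where i: "i \<in> I" using players_nonempty by auto
    \<comment> \<open>A second strategy exists because the demand is positive: one of 0 and
      \<open>d i\<close> differs from \<open>z i\<close>.\<close>
    moreover obtain y where y: "y \<in> X i" "y \<noteq> z i"
    proof (cases "z i = 0")
      case True
      then show thesis using that[of "d i"] demand_pos[OF i] by (simp add: X_def)
    next
      case False
      then show thesis using that[of 0] demand_pos[OF i] by (simp add: X_def)
    qed
    moreover have "u i (z(i := y)) < u i z"
      using z i y by (simp add: strict_nash_equilibria_def)
    ultimately show False
      using payoff_nonneg[of i "z(i := y)"] by (simp add: u_def)
  qed
  ultimately show ?thesis by simp
qed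

lemma strict_subset_strong: "strict_nash_equilibria I X u \<subseteq> strong_nash_equilibria I X u"
  using strict_exact_use exact_use_strong by (auto simp: strict_nash_equilibria_def)

text \<open>A player with demand 0 has payoff 0 and cannot be made worse off by its own deviation. A
  player with positive demand loses value by taking less, and its whole positive payoff by taking
  more.\<close>

lemma exact_use_strict_iff:
  assumes z: "z \<in> Pi\<^sub>E I X" and exact: "sum z I = r"
  shows "z \<in> strict_nash_equilibria I X u \<longleftrightarrow> (\<forall>i\<in>I. z i \<noteq> 0)"
proof
  assume strict: "z \<in> strict_nash_equilibria I X u"
  show "\<forall>i\<in>I. z i \<noteq> 0"
  proof (intro ballI notI)
    fix i assume i: "i \<in> I" and zero: "z i = 0"
    have dX: "d i \<in> X i - {z i}"
      using demand_pos[OF i] zero by (simp add: X_def)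
    then have "u i (z(i := d i)) < u i z"
      using strict i by (simp add: strict_nash_equilibria_def)
    moreover have "0 \<le> u i (z(i := d i))"
      using i dX by (intro payoff_nonneg) auto
    ultimately show False
      using exact zero value_zero[OF i] by (simp add: u_def)
  qed
next
  assume nz: "\<forall>i\<in>I. z i \<noteq> 0"
  show "z \<in> strict_nash_equilibria I X u"
    unfolding strict_nash_equilibria_def
  proof (intro CollectI conjI ballI z)
    fix i y assume i: "i \<in> I" and y: "y \<in> X i - {z i}"
    have zi: "z i \<in> X i" using z i by (rule PiE_mem)
    then have "0 < v i (z i)"
      using value_pos[OF i zi] nz i by (force simp: X_def)
    moreover have "v i y < v i (z i)" if "y < z i"
      using value_less[OF i _ zi that] y by simp
    moreover have "sum (z(i := y)) I = r + (y - z i)"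
      using sum_update[OF i, of z y] sum_others[OF i, of z] exact by simp
    ultimately show "u i (z(i := y)) < u i z"
      using y exact by (auto simp: u_def)
  qed
qed

text \<open>Under overuse everybody has payoff 0, and the grand coalition improves on this by
  sharing a nonempty pool.\<close>

lemma strong_exact_use_iff:
  assumes "0 < r" and z: "z \<in> Pi\<^sub>E I X"
  shows "z \<in> strong_nash_equilibria I X u \<longleftrightarrow> sum z I = r"
proof
  assume strong: "z \<in> strong_nash_equilibria I X u"
  then have "r \<le> sum z I"
    using strong_nash_subset_nash nash_exhausts_pool by blast
  moreover have "\<not> r < sum z I"
  proof
    assume over: "r < sum z I"
    \<comment> \<open>The pool is shared in proportion to the demands; by scarcity the factor is at
      most 1, so each share is a strategy.\<close>
    define y where "y = (\<lambda>i\<in>I. r / sum d I * d i)"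
    have q: "0 < r / sum d I" "r / sum d I \<le> 1"
      using \<open>0 < r\<close> scarcity by simp_all
    have yX: "y i \<in> X i" "0 < y i" if "i \<in> I" for i
      using that demand_pos[OF that] q mult_right_mono[of "r / sum d I" 1 "d i"]
        mult_pos_pos[of "r / sum d I" "d i"]
      by (simp_all add: y_def X_def)
    have "sum y I = r / sum d I * sum d I"
      by (simp add: y_def sum_distrib_left)
    also have "\<dots> = r"
      using \<open>0 < r\<close> scarcity by simp
    finally have "sum y I = r" .
    moreover have "override_on z y I = y"
      using PiE_arb[OF z] by (auto simp: override_on_def y_def fun_eq_iff)
    ultimately have "\<forall>i\<in>I. u i z < u i (override_on z y I)"
      using over value_pos yX by (simp add: u_def)
    moreover have "y \<in> Pi\<^sub>E I X"
      using yX(1) by (auto simp: y_def)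
    ultimately show False
      using strong players_nonempty unfolding strong_nash_equilibria_def by blast
  qed
  ultimately show "sum z I = r" by simp
qed (rule exact_use_strong[OF z])

section \<open>The empty pool, where all payoffs vanish\<close>

lemma payoff_empty_pool:
  assumes "r = 0" and z: "\<And>i. i \<in> I \<Longrightarrow> z i \<in> X i" and i: "i \<in> I"
  shows "u i z = 0"
proof (cases "0 < sum z I")
  case False
  have nonneg: "\<And>j. j \<in> I \<Longrightarrow> 0 \<le> z j" using z by (simp add: X_def)
  then have "sum z I = 0" using False sum_nonneg[of I z] by simp
  then have "z i = 0" using nonneg i finite_players by (simp add: sum_nonneg_eq_0_iff)
  then show ?thesis using value_zero[OF i] by (simp add: u_def)
next
  case True
  then show ?thesis unfolding u_def using \<open>r = 0\<close> by simp
qed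

text \<open>With constant payoffs nobody can gain. This degenerate case is the reason for the
  condition \<open>0 < r\<close> in \<open>strong_psubset_nash_iff\<close>.\<close>

lemma strong_empty_pool:
  assumes "r = 0"
  shows "strong_nash_equilibria I X u = Pi\<^sub>E I X"
proof -
  have "u i (override_on z y M) = u i z"
    if "z \<in> Pi\<^sub>E I X" "M \<subseteq> I" "y \<in> Pi\<^sub>E M X" "i \<in> M" for z M y i
  proof -
    have "u i (override_on z y M) = 0"
      using that by (intro payoff_empty_pool[OF assms]) (auto simp: override_on_def)
    moreover have "u i z = 0"
      using that by (intro payoff_empty_pool[OF assms]) auto
    ultimately show ?thesis by simp
  qed
  then show ?thesis unfolding strong_nash_equilibria_def by fastforce
qed

section \<open>When the inclusions are proper\<close>

lemma exact_use_without:
  assumes i: "i \<in> I" and le: "r \<le> sum d I - d i"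
  obtains z where "z \<in> Pi\<^sub>E I X" "sum z I = r" "z i = 0"
proof -
  define D where "D = sum d (I - {i})"
  have rD: "r \<le> D" using le sum_others[OF i, of d] by (simp add: D_def)
  \<comment> \<open>The demands of the others are scaled down to the total \<open>r\<close>. If
    \<open>D = 0\<close>, then \<open>r = 0\<close> as well, and division by zero gives
    \<open>q = 0\<close>, so \<open>q * D = r\<close> still holds.\<close>
  define q where "q = r / D"
  have q: "0 \<le> q" "q \<le> 1" and qD: "q * D = r"
    using rD pool_nonneg by (auto simp: q_def divide_le_eq_1)
  define z where "z = (\<lambda>j\<in>I. if j = i then 0 else q * d j)"
  have "z \<in> Pi\<^sub>E I X"
    unfolding z_def X_def
  proof (rule restrict_PiE[THEN iffD2], rule Pi_I)
    fix j assume "j \<in> I"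
    then show "(if j = i then 0 else q * d j) \<in> {0..d j}"
      using q demand_pos[of j] mult_right_mono[of q 1 "d j"] by auto
  qed
  moreover have "sum z (I - {i}) = q * D"
    unfolding D_def sum_distrib_left by (rule sum.cong) (auto simp: z_def)
  then have "sum z I = r"
    using sum_others[OF i, of z] i qD by (simp add: z_def)
  moreover have "z i = 0" using i by (simp add: z_def)
  ultimately show thesis by (rule that)
qed

text \<open>The profiles that separate the two sets use the pool exactly while some player takes
  nothing; they exist iff the other players can absorb the whole pool.\<close>

lemma strict_psubset_strong_iff:
  "strict_nash_equilibria I X u \<subset> strong_nash_equilibria I X u \<longleftrightarrow> (\<exists>i\<in>I. r \<le> sum d I - d i)"
proof
  assume "strict_nash_equilibria I X u \<subset> strong_nash_equilibria I X u"
  then obtain z where strong: "z \<in> strong_nash_equilibria I X u"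
    and not_strict: "z \<notin> strict_nash_equilibria I X u" by blast
  have z: "z \<in> Pi\<^sub>E I X" using strong by (simp add: strong_nash_equilibria_def)
  show "\<exists>i\<in>I. r \<le> sum d I - d i"
  proof (cases "r = 0")
    \<comment> \<open>Strong equilibria need not use an empty pool exactly, but then the condition
      holds for every player.\<close>
    case True
    obtain i where i: "i \<in> I" using players_nonempty by auto
    have "d i \<le> sum d I"
      using i finite_players demand_pos by (intro member_le_sum) (auto intro: less_imp_le)
    then show ?thesis using i True by auto
  next
    case False
    then have exact: "sum z I = r"
      using strong_exact_use_iff[OF _ z] strong pool_nonneg by simp
    then obtain i where i: "i \<in> I" "z i = 0"
      using exact_use_strict_iff[OF z] not_strict by blast
    have "sum z (I - {i}) \<le> sum d (I - {i})"
      using strategy_bounds[OF z] by (intro sum_mono) auto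
    then show ?thesis
      using i exact sum_others[OF i(1), of z] sum_others[OF i(1), of d] by force
  qed
next
  assume "\<exists>i\<in>I. r \<le> sum d I - d i"
  then obtain i z where "i \<in> I" "z \<in> Pi\<^sub>E I X" "sum z I = r" "z i = 0"
    using exact_use_without by metis
  then show "strict_nash_equilibria I X u \<subset> strong_nash_equilibria I X u"
    using exact_use_strong exact_use_strict_iff strict_subset_strong by blast
qed

text \<open>A Nash equilibrium that is not strong overuses the pool, so by
  \<open>nash_overuse\<close> the others reach \<open>r\<close> without any given player.
  Conversely, the profile of full demands is then a Nash equilibrium with overuse.\<close>

lemma strong_psubset_nash_iff:
  "strong_nash_equilibria I X u \<subset> nash_equilibria I X u \<longleftrightarrow>
     0 < r \<and> (\<forall>i\<in>I. r \<le> sum d I - d i)"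
proof
  assume "strong_nash_equilibria I X u \<subset> nash_equilibria I X u"
  then obtain z where nash: "z \<in> nash_equilibria I X u"
    and not_strong: "z \<notin> strong_nash_equilibria I X u" by blast
  have z: "z \<in> Pi\<^sub>E I X" using nash by (simp add: nash_equilibria_def)
  have "r \<noteq> 0" using strong_empty_pool z not_strong by blast
  moreover have over: "r < sum z I"
    using nash_exhausts_pool[OF nash] exact_use_strong[OF z] not_strong by fastforce
  moreover have "r \<le> sum d I - d i" if i: "i \<in> I" for i
  proof -
    have "sum z (I - {i}) \<le> sum d (I - {i})"
      using strategy_bounds[OF z] by (intro sum_mono) auto
    then show ?thesis
      using nash_overuse[OF nash over i] sum_others[OF i, of d] by simp
  qed
  ultimately show "0 < r \<and> (\<forall>i\<in>I. r \<le> sum d I - d i)"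
    using pool_nonneg by auto
next
  assume *: "0 < r \<and> (\<forall>i\<in>I. r \<le> sum d I - d i)"
  define z where "z = restrict d I"
  have z: "z \<in> Pi\<^sub>E I X"
    using demand_pos by (auto simp: z_def X_def less_imp_le)
  have over: "r < sum z I" using scarcity by (simp add: z_def)
  then have "z \<notin> strong_nash_equilibria I X u"
    using strong_exact_use_iff[OF _ z] * by simp
  moreover have "u i (z(i := y)) \<le> u i z" if i: "i \<in> I" and y: "y \<in> X i" for i y
  proof (cases "y = 0")
    case True
    then show ?thesis
      using over value_zero[OF i] by (simp add: u_def)
  next
    case False
    have "sum z (I - {i}) = sum d (I - {i})" by (rule sum.cong) (auto simp: z_def)
    \<comment> \<open>The others alone demand at least \<open>r\<close>, so every positive
      \<open>y\<close> still exceeds the pool.\<close>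
    then have "r < sum (z(i := y)) I"
      using False y * i sum_update[OF i, of z y] sum_others[OF i, of d] by (force simp: X_def)
    then show ?thesis using over by (simp add: u_def)
  qed
  then have "z \<in> nash_equilibria I X u"
    using z by (simp add: nash_equilibria_def)
  ultimately show "strong_nash_equilibria I X u \<subset> nash_equilibria I X u"
    using strong_nash_subset_nash by blast
qed

end


section \<open>The value of a coalition\<close>

text \<open>Tychonoff's theorem for the product topology on functions.\<close>

lemma compact_box:
  fixes K :: "'a \<Rightarrow> 'b::topological_space set"
  assumes "\<And>i. compact (K i)"
  shows "compact (Pi UNIV K)"
  using compactin_PiE[of "\<lambda>_. euclidean" UNIV K] assms
  by (simp add: euclidean_product_topology PiE_UNIV_domain)

text \<open>The conditions on a single coalition, without the assumption that its value is positive
  for some demand: the existence of maxima does not depend on it.\<close>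

locale coalition =
  fixes L :: lp_situation and S :: "nat set"
  assumes endow_nonneg: "t \<in> {1..num_resources L} \<Longrightarrow> 0 \<le> coalition_endow L S t"
    and tech_nonneg:
      "\<lbrakk>t \<in> {1..num_resources L + 1}; j \<in> {1..num_goods L}\<rbrakk> \<Longrightarrow> 0 \<le> tech L t j"
    and tech_pool_pos: "j \<in> {1..num_goods L} \<Longrightarrow> 0 < tech L (num_resources L + 1) j"
    and tech_pos: "j \<in> {1..num_goods L} \<Longrightarrow> \<exists>t\<in>{1..num_resources L}. 0 < tech L t j"
    and cost_nonneg: "0 \<le> unit_cost L"
begin

section \<open>Compactness of the set of plans\<close>

definition revenue :: "(nat \<Rightarrow> real) \<Rightarrow> real"
  where "revenue x = (\<Sum>j=1..num_goods L. price L j * x j)"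

definition pool_use :: "(nat \<Rightarrow> real) \<Rightarrow> real"
  where "pool_use x = (\<Sum>j=1..num_goods L. tech L (num_resources L + 1) j * x j)"

text \<open>Plans vanish outside the goods, so that they form a compact set.\<close>

definition plans :: "(nat \<Rightarrow> real) set"
  where "plans = {x. (\<forall>j. j \<notin> {1..num_goods L} \<longrightarrow> x j = 0) \<and> (\<exists>z. feasible_plan L S z x)}"

lemma feasible_plan_iff:
  "feasible_plan L S z x \<longleftrightarrow> (\<exists>y. feasible_plan L S y x) \<and> pool_use x \<le> z"
  by (auto simp: feasible_plan_def pool_use_def)

lemma feasible_plan_zero: "0 \<le> z \<Longrightarrow> feasible_plan L S z (\<lambda>_. 0)"
  using endow_nonneg by (simp add: feasible_plan_def)

lemma zero_plan: "(\<lambda>_. 0) \<in> plans"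
  using feasible_plan_zero[of 0] by (auto simp: plans_def)

lemma pool_use_nonneg: "feasible_plan L S z x \<Longrightarrow> 0 \<le> pool_use x"
  using tech_nonneg by (auto simp: feasible_plan_def pool_use_def intro!: sum_nonneg)

text \<open>Entries outside the goods affect none of the sums and may be reset to 0, so that maxima
  over \<open>plans\<close> are maxima over all feasible plans.\<close>

lemma feasible_planE:
  assumes "feasible_plan L S z x"
  obtains x' where "x' \<in> plans" "feasible_plan L S z x'" "revenue x' = revenue x"
    "pool_use x' = pool_use x"
proof
  let ?x = "\<lambda>j. if j \<in> {1..num_goods L} then x j else 0"
  have eq: "(\<Sum>j=1..num_goods L. c j * ?x j) = (\<Sum>j=1..num_goods L. c j * x j)" for c :: "nat \<Rightarrow> real"
    by (rule sum.cong) auto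
  show feas: "feasible_plan L S z ?x"
    using assms unfolding feasible_plan_def eq by simp
  then show "?x \<in> plans" unfolding plans_def by auto
  show "revenue ?x = revenue x" "pool_use ?x = pool_use x"
    unfolding revenue_def pool_use_def eq by simp_all
qed

lemma continuous_on_linear_form:
  "continuous_on A (\<lambda>x :: nat \<Rightarrow> real. \<Sum>j\<in>J. c j * x j)"
  by (intro continuous_intros continuous_on_subset[OF continuous_on_product_coordinates]) auto

lemma continuous_on_revenue: "continuous_on A revenue"
  and continuous_on_pool_use: "continuous_on A pool_use"
  unfolding revenue_def[abs_def] pool_use_def[abs_def] by (rule continuous_on_linear_form)+

text \<open>Each good consumes some resource owned by the coalition, whose endowment bounds the
  output whatever \<open>z\<close> is.\<close>

lemma plan_bounded: "\<exists>m. \<forall>x z. feasible_plan L S z x \<longrightarrow> j \<in> {1..num_goods L} \<longrightarrow> x j \<le> m"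
proof (cases "j \<in> {1..num_goods L}")
  case True
  obtain t where t: "t \<in> {1..num_resources L}" "0 < tech L t j"
    using tech_pos[OF True] by blast
  have "x j \<le> coalition_endow L S t / tech L t j" if "feasible_plan L S z x" for x z
  proof -
    have "tech L t j * x j \<le> (\<Sum>j=1..num_goods L. tech L t j * x j)"
      using that tech_nonneg[of t] t True
      by (intro member_le_sum[of j _ "\<lambda>j. tech L t j * x j"]) (auto simp: feasible_plan_def)
    also have "\<dots> \<le> coalition_endow L S t"
      using that t by (simp add: feasible_plan_def)
    finally show ?thesis using t by (simp add: field_simps)
  qed
  then show ?thesis by blast
qed auto

lemma compact_plans: "compact plans"
proof -
  obtain m where m: "\<And>j x z. \<lbrakk>feasible_plan L S z x; j \<in> {1..num_goods L}\<rbrakk> \<Longrightarrow> x j \<le> m j"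
    using plan_bounded by metis
  let ?K = "\<lambda>j. if j \<in> {1..num_goods L} then {0..m j} else {0}"
  let ?C = "\<lambda>t. {x :: nat \<Rightarrow> real. (\<Sum>j=1..num_goods L. tech L t j * x j) \<le> coalition_endow L S t}"
  have eq: "plans = Pi UNIV ?K \<inter> (\<Inter>t\<in>{1..num_resources L}. ?C t)"
  proof (intro equalityI subsetI)
    fix x assume "x \<in> plans"
    then obtain z where feas: "feasible_plan L S z x"
      and zero: "\<forall>j. j \<notin> {1..num_goods L} \<longrightarrow> x j = 0"
      by (auto simp: plans_def)
    have "x j \<in> ?K j" for j
      using feas zero m[OF feas] by (auto simp: feasible_plan_def)
    then show "x \<in> Pi UNIV ?K \<inter> (\<Inter>t\<in>{1..num_resources L}. ?C t)"
      using feas by (auto simp: feasible_plan_def)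
  next
    fix x assume x: "x \<in> Pi UNIV ?K \<inter> (\<Inter>t\<in>{1..num_resources L}. ?C t)"
    then have "x j \<in> ?K j" for j by blast
    then have "\<forall>j\<in>{1..num_goods L}. 0 \<le> x j" "\<forall>j. j \<notin> {1..num_goods L} \<longrightarrow> x j = 0"
      by (metis atLeastAtMost_iff, metis singletonD)
    \<comment> \<open>The pool constraint does not restrict \<open>plans\<close>, since the plan's
      own pool use serves as \<open>z\<close>.\<close>
    moreover from this(1) have "feasible_plan L S (pool_use x) x"
      using x by (simp add: feasible_plan_def pool_use_def)
    ultimately show "x \<in> plans" by (auto simp: plans_def)
  qed
  have "closed (?C t)" for t
    by (intro closed_Collect_le continuous_on_linear_form continuous_on_const)
  then show ?thesis
    unfolding eq by (intro compact_Int_closed compact_box closed_INT) auto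
qed

section \<open>Existence and concavity of the value\<close>

lemma coalition_value_attained:
  assumes "0 \<le> z"
  obtains x where "feasible_plan L S z x" "coalition_value L S z = revenue x - unit_cost L * z"
    "\<And>y. feasible_plan L S z y \<Longrightarrow> revenue y - unit_cost L * z \<le> coalition_value L S z"
proof -
  \<comment> \<open>The continuous revenue attains its maximum on this compact set, which contains
    the zero plan; only then does \<open>GREATEST\<close> denote the maximum.\<close>
  let ?F = "plans \<inter> {x. pool_use x \<le> z}"
  have "closed {x. pool_use x \<le> z}"
    by (intro closed_Collect_le continuous_on_pool_use continuous_on_const)
  then have "compact ?F" by (intro compact_Int_closed compact_plans)
  moreover have "(\<lambda>_. 0) \<in> ?F" using zero_plan assms by (simp add: pool_use_def)
  ultimately have "\<exists>x\<in>?F. \<forall>y\<in>?F. revenue y \<le> revenue x"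
    by (intro continuous_attains_sup continuous_on_revenue) auto
  then obtain x where x: "x \<in> ?F" "\<And>y. y \<in> ?F \<Longrightarrow> revenue y \<le> revenue x"
    by blast
  have feas: "feasible_plan L S z x"
    using x(1) by (auto simp: plans_def feasible_plan_iff[of z])
  have max: "revenue y \<le> revenue x" if feas_y: "feasible_plan L S z y" for y
  proof -
    obtain y' where y': "y' \<in> plans" "feasible_plan L S z y'" "revenue y' = revenue y"
      using feasible_planE[OF feas_y] by metis
    then show ?thesis using x(2)[of y'] feasible_plan_iff[of z y'] by simp
  qed
  have "coalition_value L S z = revenue x - unit_cost L * z"
    unfolding coalition_value_def revenue_def[symmetric]
    using feas max by (intro Greatest_equality) auto
  with feas max show thesis by (intro that) auto
qed

lemma coalition_value_ge:
  "\<lbrakk>0 \<le> z; feasible_plan L S z x\<rbrakk> \<Longrightarrow> revenue x - unit_cost L * z \<le> coalition_value L S z"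
  using coalition_value_attained by metis

text \<open>Every good needs the common-pool resource, so nothing can be produced without
  it.\<close>

lemma coalition_value_zero: "coalition_value L S 0 = 0"
proof -
  obtain x where x: "feasible_plan L S 0 x" "coalition_value L S 0 = revenue x - unit_cost L * 0"
    using coalition_value_attained[of 0] by auto
  have nonneg: "\<forall>j\<in>{1..num_goods L}. 0 \<le> tech L (num_resources L + 1) j * x j"
    using x(1) tech_nonneg by (auto simp: feasible_plan_def)
  have "pool_use x = 0"
    using x(1) pool_use_nonneg[OF x(1)] feasible_plan_iff[of 0 x] by auto
  then have "\<forall>j\<in>{1..num_goods L}. tech L (num_resources L + 1) j * x j = 0"
    using nonneg unfolding pool_use_def by (subst (asm) sum_nonneg_eq_0_iff) auto
  then have "\<forall>j\<in>{1..num_goods L}. x j = 0"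
    using tech_pool_pos by fastforce
  then show ?thesis using x(2) by (simp add: revenue_def)
qed

text \<open>A convex combination of optimal plans for \<open>a\<close> and \<open>b\<close> is
  feasible for the same combination of \<open>a\<close> and \<open>b\<close>.\<close>

lemma coalition_value_concave:
  assumes "0 \<le> a" "0 \<le> b" "0 \<le> l" "l \<le> 1"
  shows "(1 - l) * coalition_value L S a + l * coalition_value L S b
    \<le> coalition_value L S ((1 - l) * a + l * b)"
proof -
  obtain x where x: "feasible_plan L S a x" "coalition_value L S a = revenue x - unit_cost L * a"
    using coalition_value_attained[OF assms(1)] by auto
  obtain y where y: "feasible_plan L S b y" "coalition_value L S b = revenue y - unit_cost L * b"
    using coalition_value_attained[OF assms(2)] by auto
  define w where "w = (\<lambda>j. (1 - l) * x j + l * y j)"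
  have eq: "(\<Sum>j=1..num_goods L. c j * w j) =
      (1 - l) * (\<Sum>j=1..num_goods L. c j * x j) + l * (\<Sum>j=1..num_goods L. c j * y j)"
    for c :: "nat \<Rightarrow> real"
    by (simp add: w_def sum_distrib_left distrib_left sum.distrib mult.left_commute)
  have le: "(1 - l) * p + l * q \<le> (1 - l) * p' + l * q'" if "p \<le> p'" "q \<le> q'" for p q p' q' :: real
    using that assms by (intro add_mono mult_left_mono) auto
  have "feasible_plan L S ((1 - l) * a + l * b) w"
    unfolding feasible_plan_def
  proof (intro conjI ballI)
    show "0 \<le> w j" if "j \<in> {1..num_goods L}" for j
      using that x(1) y(1) assms by (simp add: w_def feasible_plan_def)
    show "(\<Sum>j=1..num_goods L. tech L t j * w j) \<le> coalition_endow L S t"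
      if "t \<in> {1..num_resources L}" for t
    proof -
      have "(1 - l) * (\<Sum>j=1..num_goods L. tech L t j * x j) +
          l * (\<Sum>j=1..num_goods L. tech L t j * y j)
        \<le> (1 - l) * coalition_endow L S t + l * coalition_endow L S t"
        using that x(1) y(1) by (intro le) (simp_all add: feasible_plan_def)
      then show ?thesis unfolding eq by (simp add: algebra_simps)
    qed
    show "(\<Sum>j=1..num_goods L. tech L (num_resources L + 1) j * w j) \<le> (1 - l) * a + l * b"
      using le[of _ a _ b] x(1) y(1) unfolding eq by (simp add: feasible_plan_def)
  qed
  then have "revenue w - unit_cost L * ((1 - l) * a + l * b)
      \<le> coalition_value L S ((1 - l) * a + l * b)"
    using assms by (intro coalition_value_ge) auto
  then show ?thesis
    unfolding x(2) y(2) revenue_def eq by (simp add: algebra_simps)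
qed

section \<open>The optimal demand and strict growth up to it\<close>

text \<open>A maximizer of the value is the pool use of a plan that maximizes
  the profit \<open>revenue x - unit_cost L * pool_use x\<close>, so the least one minimizes the pool use over
  a compact set. Maximizers are not unique in general if \<open>unit_cost L = 0\<close>.\<close>

lemma optimal_demand_least_maximizer:
  shows optimal_demand_nonneg: "0 \<le> optimal_demand L S"
    and optimal_demand_max: "0 \<le> y \<Longrightarrow> coalition_value L S y \<le> coalition_value L S (optimal_demand L S)"
    and optimal_demand_le: "\<lbrakk>0 \<le> z; \<And>y. 0 \<le> y \<Longrightarrow> coalition_value L S y \<le> coalition_value L S z\<rbrakk>
      \<Longrightarrow> optimal_demand L S \<le> z"
proof -
  define profit where "profit = (\<lambda>x. revenue x - unit_cost L * pool_use x)"
  have cont: "continuous_on A profit" for A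
    unfolding profit_def by (intro continuous_intros continuous_on_revenue continuous_on_pool_use)
  obtain x0 where x0: "x0 \<in> plans" "\<And>x. x \<in> plans \<Longrightarrow> profit x \<le> profit x0"
    using continuous_attains_sup[OF compact_plans _ cont] zero_plan by (metis empty_iff)
  let ?M = "plans \<inter> {x. profit x0 \<le> profit x}"
  have "closed {x. profit x0 \<le> profit x}"
    by (intro closed_Collect_le cont continuous_on_const)
  then have "compact ?M"
    by (intro compact_Int_closed compact_plans)
  moreover have "x0 \<in> ?M" using x0(1) by simp
  ultimately have "\<exists>x\<in>?M. \<forall>y\<in>?M. pool_use x \<le> pool_use y"
    by (intro continuous_attains_inf continuous_on_pool_use) auto
  then obtain x1 where x1: "x1 \<in> plans" "profit x0 \<le> profit x1"
    "\<And>x. x \<in> plans \<Longrightarrow> profit x0 \<le> profit x \<Longrightarrow> pool_use x1 \<le> pool_use x"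
    by auto
  define d where "d = pool_use x1"
  have feas: "feasible_plan L S d x1"
    using x1(1) by (auto simp: plans_def d_def feasible_plan_iff[of "pool_use x1"])
  have d: "0 \<le> d" unfolding d_def using feas by (rule pool_use_nonneg)
  have ge: "profit x0 \<le> coalition_value L S d"
    using coalition_value_ge[OF d feas] x1(2) by (simp add: profit_def d_def)
  have attained: "\<exists>x\<in>plans. pool_use x \<le> y \<and> coalition_value L S y \<le> profit x" if y: "0 \<le> y" for y
  proof -
    obtain x where x: "feasible_plan L S y x" "coalition_value L S y = revenue x - unit_cost L * y"
      using coalition_value_attained[OF y] by auto
    obtain x' where "x' \<in> plans" "revenue x' = revenue x" "pool_use x' = pool_use x"
      using feasible_planE[OF x(1)] by auto
    moreover have "pool_use x \<le> y" using x(1) feasible_plan_iff[of y x] by simp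
    ultimately show ?thesis
      using x(2) mult_left_mono[OF _ cost_nonneg] by (intro bexI[of _ x']) (auto simp: profit_def)
  qed
  have max: "coalition_value L S y \<le> coalition_value L S d" if "0 \<le> y" for y
    using attained[OF that] x0(2) ge by (meson order_trans)
  have least: "d \<le> z" if z: "0 \<le> z" "\<forall>y\<ge>0. coalition_value L S y \<le> coalition_value L S z" for z
  proof -
    obtain x where x: "x \<in> plans" "pool_use x \<le> z" "coalition_value L S z \<le> profit x"
      using attained[OF z(1)] by blast
    have "profit x0 \<le> profit x" using ge z(2) d x(3) by (meson order_trans)
    then show ?thesis using x1(3) x(1,2) by (force simp: d_def)
  qed
  have eq: "optimal_demand L S = d"
    unfolding optimal_demand_def using d max least by (intro Least_equality) auto
  show "0 \<le> optimal_demand L S"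
    "0 \<le> y \<Longrightarrow> coalition_value L S y \<le> coalition_value L S (optimal_demand L S)"
    "\<lbrakk>0 \<le> z; \<And>y. 0 \<le> y \<Longrightarrow> coalition_value L S y \<le> coalition_value L S z\<rbrakk>
      \<Longrightarrow> optimal_demand L S \<le> z"
    unfolding eq using d max least by auto
qed

text \<open>A point below the least maximizer has a strictly smaller value than it, and concavity
  carries this over to the points in between.\<close>

lemma coalition_value_strict_mono: "strict_mono_on {0..optimal_demand L S} (coalition_value L S)"
proof (rule strict_mono_onI)
  let ?v = "coalition_value L S" and ?d = "optimal_demand L S"
  fix y z assume y: "y \<in> {0..?d}" and z: "z \<in> {0..?d}" and "y < z"
  then have yd: "0 \<le> y" "y < ?d" by auto
  have "\<not> (\<forall>w\<ge>0. ?v w \<le> ?v y)" using optimal_demand_le[of y] yd by force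
  then have less: "?v y < ?v ?d" using optimal_demand_max by (meson not_le order_trans)
  \<comment> \<open>The position of \<open>z\<close> on the segment from \<open>y\<close> to the
    optimal demand.\<close>
  define l where "l = (z - y) / (?d - y)"
  have l: "0 < l" "l \<le> 1" using z yd \<open>y < z\<close> by (auto simp: l_def)
  have "l * (?d - y) = z - y" using yd by (simp add: l_def)
  then have "(1 - l) * y + l * ?d = z" by (simp add: algebra_simps)
  then have "(1 - l) * ?v y + l * ?v ?d \<le> ?v z"
    using coalition_value_concave[of y ?d l] yd l by simp
  moreover have "l * ?v y < l * ?v ?d" using l less by simp
  ultimately show "?v y < ?v z" by (simp add: algebra_simps)
qed

end


section \<open>The game among the coalitions of a partition\<close>

lemma valid_situation_coalition:
  assumes "valid_situation L" and "S \<subseteq> {1..num_producers L}"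
  shows "coalition L S"
proof
  have "\<forall>t\<in>{1..num_resources L}. \<forall>i\<in>{1..num_producers L}. 0 \<le> endow L t i"
    using assms(1) by (simp add: valid_situation_def)
  then show "0 \<le> coalition_endow L S t" if "t \<in> {1..num_resources L}" for t
    using assms(2) that unfolding coalition_endow_def by (intro sum_nonneg) blast
qed (use assms(1) in \<open>simp_all add: valid_situation_def del: One_nat_def\<close>)

text \<open>The standing assumption yields a positive value somewhere, so 0 is not a
  maximizer.\<close>

lemma optimal_demand_pos:
  assumes "valid_situation L" and S: "S \<subseteq> {1..num_producers L}" "S \<noteq> {}"
  shows "0 < optimal_demand L S"
proof -
  interpret coalition L S using assms by (intro valid_situation_coalition)
  have "\<exists>x z. 0 \<le> z \<and> feasible_plan L S z x \<and> 0 < coalition_value L S z"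
    using assms by (simp add: valid_situation_def)
  then obtain z where z: "0 \<le> z" "0 < coalition_value L S z"
    by blast
  then have "optimal_demand L S \<noteq> 0"
    using optimal_demand_max[OF z(1)] coalition_value_zero by auto
  then show ?thesis using optimal_demand_nonneg by simp
qed

lemma pool_game_coalitions:
  assumes L: "valid_situation L" and P: "partition_on {1..num_producers L} P"
    and "pool L < total_demand L P"
  shows "pool_game P (optimal_demand L) (coalition_value L) (pool L)"
proof
  have S: "S \<subseteq> {1..num_producers L}" "S \<noteq> {}" if "S \<in> P" for S
    using that partition_onD1[OF P] partition_onD3[OF P] by auto
  show "finite P" using finite_elements[OF _ P] by simp
  show "P \<noteq> {}" using partition_onD1[OF P] L by (auto simp: valid_situation_def)
  show "0 < optimal_demand L S" if "S \<in> P" for S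
    using L S[OF that] by (rule optimal_demand_pos)
  show "coalition_value L S 0 = 0" "strict_mono_on {0..optimal_demand L S} (coalition_value L S)"
    if "S \<in> P" for S
    using coalition.coalition_value_zero coalition.coalition_value_strict_mono
      valid_situation_coalition[OF L S(1)[OF that]] by blast+
  show "0 \<le> pool L" using L by (simp add: valid_situation_def)
  show "pool L < sum (optimal_demand L) P" using assms(3) by (simp add: total_demand_def)
qed

section \<open>An instance in which both inclusions are proper\<close>

lemma coalition_endow_pool_update [simp]: "coalition_endow (L\<lparr>pool := r\<rparr>) = coalition_endow L"
  by (simp add: coalition_endow_def fun_eq_iff)

lemma feasible_plan_pool_update [simp]: "feasible_plan (L\<lparr>pool := r\<rparr>) = feasible_plan L"
  by (simp add: feasible_plan_def fun_eq_iff)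

lemma coalition_value_pool_update [simp]: "coalition_value (L\<lparr>pool := r\<rparr>) = coalition_value L"
  by (simp add: coalition_value_def fun_eq_iff)

lemma optimal_demand_pool_update [simp]: "optimal_demand (L\<lparr>pool := r\<rparr>) = optimal_demand L"
  by (simp add: optimal_demand_def fun_eq_iff)

lemma total_demand_pool_update [simp]: "total_demand (L\<lparr>pool := r\<rparr>) = total_demand L"
  by (simp add: total_demand_def fun_eq_iff)

text \<open>As values and demands do not depend on the pool, its amount can be chosen after the
  demands are fixed.\<close>

lemma valid_situation_pool_update: "\<lbrakk>valid_situation L; 0 \<le> r\<rbrakk> \<Longrightarrow> valid_situation (L\<lparr>pool := r\<rparr>)"
  by (simp add: valid_situation_def)

lemma valid_situation_two_producers:
  "valid_situation \<lparr>num_producers = 2, num_resources = 1, num_goods = 1, tech = \<lambda>_ _. 1,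
    endow = \<lambda>_ _. 1, price = \<lambda>_. 2, pool = 1, unit_cost = 1\<rparr>"
  (is "valid_situation ?L")
proof -
  have "\<exists>x z. 0 \<le> z \<and> feasible_plan ?L S z x \<and> 0 < coalition_value ?L S z"
    if S: "S \<subseteq> {1..2}" "S \<noteq> {}" for S
  proof -
    have "finite S" using S finite_subset by blast
    then have card: "1 \<le> card S" using S by (simp add: Suc_le_eq card_gt_0_iff)
    interpret coalition ?L S
      by standard (auto simp: coalition_endow_def)
    \<comment> \<open>One unit of the only good earns 2 and costs 1, so the value at 1 is
      positive.\<close>
    have feas: "feasible_plan ?L S 1 (\<lambda>_. 1)"
      using card by (simp add: feasible_plan_def coalition_endow_def)
    then have "1 \<le> coalition_value ?L S 1"
      using coalition_value_ge[of 1 "\<lambda>_. 1"] unfolding revenue_def by simp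
    then show ?thesis using feas by (intro exI[of _ "\<lambda>_. 1"] exI[of _ 1]) auto
  qed
  then show ?thesis by (auto simp: valid_situation_def)
qed

text \<open>The pool is chosen as the smaller one of the two demands, so that neither coalition can
  relieve a pool that the other one exhausts.\<close>

lemma exists_proper_inclusions:
  "\<exists>L P. valid_situation L \<and> partition_on {1..num_producers L} P \<and> pool L < total_demand L P \<and>
    0 < pool L \<and> P \<noteq> {} \<and> (\<forall>S\<in>P. pool L \<le> total_demand L P - optimal_demand L S)"
proof -
  \<comment> \<open>Only validity and the two producers are kept; the demands need not be
    computed.\<close>
  obtain L where L: "valid_situation L" "num_producers L = 2"
    using valid_situation_two_producers by (metis lp_situation.select_convs(1))
  define r where "r = min (optimal_demand L {1}) (optimal_demand L {2})"
  have pos: "0 < optimal_demand L {1}" "0 < optimal_demand L {2}"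
    using optimal_demand_pos[OF L(1)] L(2) by simp_all
  have part: "partition_on {1..2} {{1}, {2 :: nat}}"
    by (auto simp: partition_on_def disjoint_def)
  have total: "total_demand L {{1}, {2}} = optimal_demand L {1} + optimal_demand L {2}"
    by (simp add: total_demand_def)
  show ?thesis
    using valid_situation_pool_update[OF L(1), of r] L(2) pos part total
    by (intro exI[of _ "L\<lparr>pool := r\<rparr>"] exI[of _ "{{1}, {2}}"]) (auto simp: r_def)
qed

text \<open>Stated apart from the theorem because it is applied both to the given game and to the
  instance above.\<close>

lemma inclusions_proper_iff:
  assumes "valid_situation L" and "partition_on {1..num_producers L} P"
    and "pool L < total_demand L P"
  shows "strict_NE L P \<subset> strong_NE L P \<longleftrightarrow>
      (\<exists>S\<in>P. pool L \<le> total_demand L P - optimal_demand L S)"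
    and "strong_NE L P \<subset> NE L P \<longleftrightarrow>
      0 < pool L \<and> (\<forall>S\<in>P. pool L \<le> total_demand L P - optimal_demand L S)"
proof -
  interpret pool_game P "optimal_demand L" "coalition_value L" "pool L"
    using assms by (rule pool_game_coalitions)
  have X: "X = strategies L" and u: "u = payoff L P"
    by (simp_all add: fun_eq_iff X_def strategies_def u_def payoff_def)
  show "strict_NE L P \<subset> strong_NE L P \<longleftrightarrow>
      (\<exists>S\<in>P. pool L \<le> total_demand L P - optimal_demand L S)"
    "strong_NE L P \<subset> NE L P \<longleftrightarrow>
      0 < pool L \<and> (\<forall>S\<in>P. pool L \<le> total_demand L P - optimal_demand L S)"
    using strict_psubset_strong_iff strong_psubset_nash_iff
    unfolding X u total_demand_def by blast+
qed

(* For a single game the inclusions in the last part may be equalities (for instance, the second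
   one always is when P = {N}); it is therefore stated as inclusion for every game, together with
   the exact conditions under which each inclusion is proper and a game where both are. *)
theorem mainTheorem4:
  fixes L :: lp_situation and P :: "nat set set"
  assumes "valid_situation L"
    and "partition_on {1..num_producers L} P"
    and "total_demand L P > pool L"
  shows "(\<forall>z \<in> strict_NE L P. z \<in> strong_NE L P) \<and>
    (\<forall>z \<in> Pi\<^sub>E P (\<lambda>S. {0..optimal_demand L S}).
       (\<Sum>S\<in>P. z S) = pool L \<and> (\<exists>S\<in>P. z S = 0) \<longrightarrow>
       z \<in> strong_NE L P \<and> z \<notin> strict_NE L P) \<and>
    (strict_NE L P \<subseteq> strong_NE L P \<and> strong_NE L P \<subseteq> NE L P \<and>
     (strict_NE L P \<subset> strong_NE L P \<longleftrightarrow>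
        (\<exists>S\<in>P. total_demand L P - optimal_demand L S \<ge> pool L)) \<and>
     (strong_NE L P \<subset> NE L P \<longleftrightarrow>
        pool L > 0 \<and> (\<forall>S\<in>P. total_demand L P - optimal_demand L S \<ge> pool L)) \<and>
     (\<exists>L' P'. valid_situation L' \<and> partition_on {1..num_producers L'} P' \<and>
        total_demand L' P' > pool L' \<and>
        strict_NE L' P' \<subset> strong_NE L' P' \<and> strong_NE L' P' \<subset> NE L' P'))"
proof -
  interpret pool_game P "optimal_demand L" "coalition_value L" "pool L"
    using assms by (intro pool_game_coalitions)
  have X: "X = strategies L" and u: "u = payoff L P"
    by (simp_all add: fun_eq_iff X_def strategies_def u_def payoff_def)
  have strict: "strict_NE L P \<subseteq> strong_NE L P"
    using strict_subset_strong unfolding X u .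
  have part_b: "z \<in> strong_NE L P \<and> z \<notin> strict_NE L P"
    if "z \<in> Pi\<^sub>E P (\<lambda>S. {0..optimal_demand L S})" "(\<Sum>S\<in>P. z S) = pool L" "\<exists>S\<in>P. z S = 0" for z
  proof -
    have "z \<in> Pi\<^sub>E P X" using that(1) by (simp add: X_def[abs_def])
    then show ?thesis
      using exact_use_strong exact_use_strict_iff that(2,3) unfolding X u by blast
  qed
  have example: "\<exists>L' P'. valid_situation L' \<and> partition_on {1..num_producers L'} P' \<and>
      total_demand L' P' > pool L' \<and> strict_NE L' P' \<subset> strong_NE L' P' \<and> strong_NE L' P' \<subset> NE L' P'"
  proof -
    obtain L' P' where L': "valid_situation L'" "partition_on {1..num_producers L'} P'"
      "pool L' < total_demand L' P'"
      and proper: "0 < pool L'" "P' \<noteq> {}" "\<forall>S\<in>P'. pool L' \<le> total_demand L' P' - optimal_demand L' S"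
      using exists_proper_inclusions by blast
    have "strict_NE L' P' \<subset> strong_NE L' P'" "strong_NE L' P' \<subset> NE L' P'"
      unfolding inclusions_proper_iff[OF L'] using proper by blast+
    then show ?thesis using L' by blast
  qed
  show ?thesis
  proof (intro conjI)
    show "\<forall>z \<in> strict_NE L P. z \<in> strong_NE L P" "strict_NE L P \<subseteq> strong_NE L P"
      using strict by auto
    show "strong_NE L P \<subseteq> NE L P" by (rule strong_nash_subset_nash)
  qed (use part_b in blast, (rule inclusions_proper_iff[OF assms] example)+)
qed

end
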